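(* The vertex-to-$K_4$ move preserves infinitesimal rigidity for finite well-positioned bar-joint frameworks in $(\mathbb{R}^2,\|\cdot\|_{\mathcal{P}})$, for any polyhedral norm $\|\cdot\|_{\mathcal P}$ on $\mathbb{R}^2$. That is: if $(G,p)$ is a finite, well-positioned and infinitesimally rigid bar-joint framework in $(\mathbb{R}^2,\|\cdot\|_{\mathcal{P}})$ and $G'$ is obtained from $G$ by a vertex-to-$K_4$ move, then there exists a placement $p'$ of $G'$ such that $(G',p')$ is well-positioned and infinitesimally rigid in $(\mathbb{R}^2,\|\cdot\|_{\mathcal{P}})$.
   Context: Let $\mathcal{P}\subset\mathbb{R}^2$ be a convex symmetric ($\mathcal P=-\mathcal P$) $2$-dimensional polytope. The associated polyhedral norm is $\|x\|_{\mathcal{P}}=\inf\{\lambda\ge 0: x\in\lambda\mathcal{P}\}$. For a facet $F$ of $\mathcal P$, $\mathrm{cone}(F)$ is the set of all finite non-negative linear combinations of points of $F$. A placement of a simple graph $G=(V(G),E(G))$ is a map $p:V(G)\to\mathbb{R}^2$ with $p_v\neq p_w$ whenever $vw\in E(G)$; the pair $(G,p)$ is a bar-joint framework, finite if $G$ is finite. It is well-positioned if for each edge $vw$ the vector $p_v-p_w$ is contained in $\mathrm{cone}(F)$ for exactly one facet $F$ of $\mathcal{P}$. An infinitesimal flex of $(G,p)$ is a map $u:V(G)\to\mathbb{R}^2$ such that for each edge $vw$, $\|(p_v+tu_v)-(p_w+tu_w)\|_{\mathcal{P}}-\|p_v-p_w\|_{\mathcal{P}}=o(t)$ as $t\to 0$;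 it is trivial if it is constant. $(G,p)$ is infinitesimally rigid if every infinitesimal flex is trivial. A vertex-to-$K_4$ move $G\to G'$ replaces a vertex $v_0\in V(G)$ with a copy of the complete graph $K_4$ by adjoining three new vertices $v_1,v_2,v_3$ and six edges $v_0v_1,v_0v_2,v_0v_3,v_1v_2,v_1v_3,v_2v_3$; each edge $v_0w$ of $G$ incident with $v_0$ may be left unchanged or replaced by one of $v_1w$, $v_2w$ or $v_3w$. *)

theory Defs
  imports "HOL-Analysis.Analysis" "HOL-Library.Landau_Symbols"
begin

definition symmetric_polytope2 :: "(real^2) set \<Rightarrow> bool" where
  "symmetric_polytope2 P \<longleftrightarrow> polytope P \<and> aff_dim P = 2 \<and> uminus ` P = P"

definition poly_norm :: "(real^2) set \<Rightarrow> real^2 \<Rightarrow> real" where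
  "poly_norm P x = Inf {l. 0 \<le> l \<and> x \<in> (*\<^sub>R) l ` P}"

definition nonneg_combinations :: "(real^2) set \<Rightarrow> (real^2) set" where
  "nonneg_combinations F =
     {\<Sum>x\<in>S. c x *\<^sub>R x |S c. finite S \<and> S \<subseteq> F \<and> (\<forall>x\<in>S. 0 \<le> (c x :: real))}"

text \<open>
  A graph is given by its vertex set and its set of edges, an edge being the
  two-element set of its endpoints.
\<close>

definition simple_graph :: "'a set \<Rightarrow> 'a set set \<Rightarrow> bool" where
  "simple_graph V E \<longleftrightarrow> (\<forall>e\<in>E. \<exists>v\<in>V. \<exists>w\<in>V. v \<noteq> w \<and> e = {v, w})"

text \<open>
  Placements and flexes are total functions; only their values on the vertex set matter.
\<close>

definition framework :: "'a set \<Rightarrow> 'a set set \<Rightarrow> ('a \<Rightarrow> real^2) \<Rightarrow> bool" where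
  "framework V E p \<longleftrightarrow> simple_graph V E \<and> (\<forall>v w. {v, w} \<in> E \<longrightarrow> p v \<noteq> p w)"

definition well_positioned :: "(real^2) set \<Rightarrow> 'a set set \<Rightarrow> ('a \<Rightarrow> real^2) \<Rightarrow> bool" where
  "well_positioned P E p \<longleftrightarrow>
     (\<forall>v w. {v, w} \<in> E \<longrightarrow> (\<exists>!F. F facet_of P \<and> p v - p w \<in> nonneg_combinations F))"

definition infinitesimal_flex ::
  "(real^2) set \<Rightarrow> 'a set set \<Rightarrow> ('a \<Rightarrow> real^2) \<Rightarrow> ('a \<Rightarrow> real^2) \<Rightarrow> bool" where
  "infinitesimal_flex P E p u \<longleftrightarrow>
     (\<forall>v w. {v, w} \<in> E \<longrightarrow>
        (\<lambda>t::real. poly_norm P ((p v + t *\<^sub>R u v) - (p w + t *\<^sub>R u w)) - poly_norm P (p v - p w))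
          \<in> o[at 0](\<lambda>t. t))"

definition infinitesimally_rigid ::
  "(real^2) set \<Rightarrow> 'a set \<Rightarrow> 'a set set \<Rightarrow> ('a \<Rightarrow> real^2) \<Rightarrow> bool" where
  "infinitesimally_rigid P V E p \<longleftrightarrow>
     (\<forall>u. infinitesimal_flex P E p u \<longrightarrow> (\<exists>c. \<forall>v\<in>V. u v = c))"

text \<open>
  The function \<open>f\<close> records, for each neighbour \<open>w\<close> of \<open>v0\<close>, the vertex of the
  new complete graph to which \<open>w\<close> is joined after the move.
\<close>

definition vertex_to_K4_move :: "'a set \<Rightarrow> 'a set set \<Rightarrow> 'a set \<Rightarrow> 'a set set \<Rightarrow> bool" where
  "vertex_to_K4_move V E V' E' \<longleftrightarrow>
     (\<exists>v0 v1 v2 v3 f.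
        v0 \<in> V \<and> v1 \<notin> V \<and> v2 \<notin> V \<and> v3 \<notin> V \<and> distinct [v1, v2, v3] \<and>
        (\<forall>w. {v0, w} \<in> E \<longrightarrow> f w \<in> {v0, v1, v2, v3}) \<and>
        V' = V \<union> {v1, v2, v3} \<and>
        E' = {e \<in> E. v0 \<notin> e} \<union> {{f w, w} |w. {v0, w} \<in> E} \<union>
             {{v0, v1}, {v0, v2}, {v0, v3}, {v1, v2}, {v1, v3}, {v2, v3}})"

end

theory Submission
  imports Defs
begin

text \<open>
  The polyhedral norm is the maximum of finitely many linear forms, one for each facet, and \<open>d\<close>
  lies in the cone of exactly one facet iff the maximum at \<open>d\<close> is attained by a unique form \<open>a\<close>.
  Then the norm agrees with \<open>a\<close> near \<open>d\<close>, so an edge in direction \<open>d\<close> only imposes the linear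
  condition \<open>a \<bullet> (u v - u w) = 0\<close> on a flex, and this condition is stable under small
  perturbations of the placement. Hence it suffices to put a small rigid copy of \<open>K\<^sub>4\<close> at the
  point \<open>p v0\<close>: a flex is constant on it, so it restricts to a flex of the original framework.
  A rigid copy exists since \<open>K\<^sub>4\<close> is the union of two spanning paths, whose edges can be
  directed into the cones of two adjacent facets.
\<close>

section \<open>Facet normals\<close>

text \<open>For a polytope with 0 in its interior these are the vertices of the polar polytope.
  Fixing the supporting value at 1 leaves one normal per facet, so that facets can be compared as
  vectors.\<close>

definition facet_normals :: "(real^2) set \<Rightarrow> (real^2) set" where
  "facet_normals P = {a. {x \<in> P. a \<bullet> x = 1} facet_of P \<and> (\<forall>x\<in>P. a \<bullet> x \<le> 1)}"

text \<open>Full dimension yields an interior point \<open>x\<close>; by symmetry \<open>- x\<close>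
  is interior too, and 0 is their midpoint.\<close>

lemma symmetric_polytope2_zero_interior:
  assumes "symmetric_polytope2 P"
  shows "0 \<in> interior P"
proof -
  have cvx: "convex P" and sym: "uminus ` P = P" and "aff_dim P = int (DIM(real^2))"
    using assms by (auto simp: symmetric_polytope2_def polytope_imp_convex)
  then have "interior P \<noteq> {}"
    by (metis aff_dim_empty aff_dim_eq_full empty_not_UNIV affine_hull_eq_empty
        rel_interior_eq_empty rel_interior_interior)
  then obtain x where x: "x \<in> interior P"
    by blast
  have "uminus ` interior P = interior P"
    using interior_negations[of P] sym by simp
  then have "- x \<in> interior P"
    using x by blast
  then have "(1/2) *\<^sub>R x + (1/2) *\<^sub>R (- x) \<in> interior P"
    using x convex_interior[OF cvx] by (intro convexD) auto
  then show ?thesis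
    by simp
qed

lemma facet_normals_nonzero:
  assumes "a \<in> facet_normals P"
  shows "a \<noteq> 0"
  using assms by (auto simp: facet_normals_def facet_of_def)

lemma facet_normal_exists:
  assumes P: "symmetric_polytope2 P" and F: "F facet_of P"
  shows "\<exists>a\<in>facet_normals P. F = {x \<in> P. a \<bullet> x = 1}"
proof -
  have "polyhedron P"
    using P by (simp add: symmetric_polytope2_def polytope_imp_polyhedron)
  then obtain a b where ab: "a \<noteq> 0" "P \<subseteq> {x. a \<bullet> x \<le> b}" "F = P \<inter> {x. a \<bullet> x = b}"
    using facet_of_polyhedron F by metis
  obtain e where e: "e > 0" "ball 0 e \<subseteq> P"
    using symmetric_polytope2_zero_interior[OF P] by (meson mem_interior)
  \<comment> \<open>A point of the ball in direction \<open>a\<close> gives \<open>a\<close> a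
    positive value on \<open>P\<close>, so \<open>b\<close> is positive and can be normalised to
    1.\<close>
  have "(e / 2 / norm a) *\<^sub>R a \<in> P"
    using e ab(1) by (intro subsetD[OF e(2)]) (auto simp: dist_norm)
  then have "(e / 2 / norm a) * (a \<bullet> a) \<le> b"
    using ab(2) by force
  moreover have "(e / 2 / norm a) * (a \<bullet> a) > 0"
    using e ab(1) by simp
  ultimately have b: "b > 0"
    by linarith
  have eq: "F = {x \<in> P. (a /\<^sub>R b) \<bullet> x = 1}"
    using ab(3) b by (auto simp: field_simps)
  moreover have "\<forall>x\<in>P. (a /\<^sub>R b) \<bullet> x \<le> 1"
    using ab(2) b by (auto simp: field_simps)
  ultimately show ?thesis
    using F unfolding facet_normals_def by blast
qed

text \<open>A facet is one-dimensional, so its affine hull is the full line on which its normal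
  takes the value 1, and this line determines the normal.\<close>

lemma facet_normal_unique:
  assumes P: "symmetric_polytope2 P" and a: "a \<in> facet_normals P" and b: "b \<in> facet_normals P"
    and eq: "{x \<in> P. a \<bullet> x = 1} = {x \<in> P. b \<bullet> x = 1}"
  shows "a = b"
proof -
  let ?F = "{x \<in> P. a \<bullet> x = 1}"
  have dim: "aff_dim ?F = 1"
    using a P by (simp add: facet_normals_def facet_of_def symmetric_polytope2_def)
  have hull: "affine hull ?F = {x. c \<bullet> x = 1}" if "c \<noteq> 0" "?F \<subseteq> {x. c \<bullet> x = 1}" for c
  proof -
    have "aff_dim {x. c \<bullet> x = 1} = 1"
      using that by simp
    then show ?thesis
      using that dim aff_dim_eq_full_gen[OF that(2)]
      by (simp add: affine_hyperplane affine_hull_eq)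
  qed
  have "{x. a \<bullet> x = 1} = {x. b \<bullet> x = 1}"
    using hull[of a] hull[of b] eq facet_normals_nonzero a b by blast
  \<comment> \<open>These are the points of the two lines closest to the origin. As the lines
    coincide, each point also satisfies the other equation, so \<open>a \<bullet> a\<close>,
    \<open>a \<bullet> b\<close> and \<open>b \<bullet> b\<close> are all equal.\<close>
  moreover have "(a /\<^sub>R (a \<bullet> a)) \<in> {x. a \<bullet> x = 1}" "(b /\<^sub>R (b \<bullet> b)) \<in> {x. b \<bullet> x = 1}"
    using facet_normals_nonzero[OF a] facet_normals_nonzero[OF b] by simp_all
  ultimately have "b \<bullet> (a /\<^sub>R (a \<bullet> a)) = 1" "a \<bullet> (b /\<^sub>R (b \<bullet> b)) = 1"
    by blast+
  then have "b \<bullet> a = a \<bullet> a" "a \<bullet> b = b \<bullet> b"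
    using facet_normals_nonzero[OF a] facet_normals_nonzero[OF b] by (simp_all add: field_simps)
  then have "(a - b) \<bullet> (a - b) = 0"
    by (simp add: inner_diff_left inner_diff_right inner_commute)
  then show ?thesis
    by simp
qed

lemma finite_facet_normals:
  assumes P: "symmetric_polytope2 P"
  shows "finite (facet_normals P)"
proof (rule inj_on_finite)
  show "inj_on (\<lambda>a. {x \<in> P. a \<bullet> x = 1}) (facet_normals P)"
    using facet_normal_unique[OF P] by (auto intro!: inj_onI)
  show "(\<lambda>a. {x \<in> P. a \<bullet> x = 1}) ` facet_normals P \<subseteq> {F. F facet_of P}"
    by (auto simp: facet_normals_def)
  show "finite {F. F facet_of P}"
    using P by (simp add: finite_polytope_facets symmetric_polytope2_def)
qed

lemma facet_normals_uminus:
  assumes P: "symmetric_polytope2 P" and a: "a \<in> facet_normals P"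
  shows "- a \<in> facet_normals P"
proof -
  let ?F = "{x \<in> P. a \<bullet> x = 1}"
  have sym: "uminus ` P = P"
    using P by (simp add: symmetric_polytope2_def)
  then have neg: "- x \<in> P" if "x \<in> P" for x
    using that by blast
  have lin: "linear (uminus :: real^2 \<Rightarrow> real^2)"
    by (simp add: linear_uminus)
  have "(uminus ` ?F) face_of (uminus ` P)" "aff_dim (uminus ` ?F) = aff_dim ?F"
    using a face_of_linear_image[OF lin] aff_dim_injective_linear_image[OF lin]
    by (auto simp: facet_normals_def facet_of_def)
  then have "(uminus ` ?F) facet_of P"
    using a sym by (simp add: facet_normals_def facet_of_def)
  moreover have "uminus ` ?F = {x \<in> P. - a \<bullet> x = 1}"
  proof
    show "{x \<in> P. - a \<bullet> x = 1} \<subseteq> uminus ` ?F"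
    proof
      fix x assume "x \<in> {x \<in> P. - a \<bullet> x = 1}"
      then have "- x \<in> ?F"
        using neg by auto
      then show "x \<in> uminus ` ?F"
        by (metis (no_types, lifting) image_eqI minus_minus)
    qed
  qed (use neg in auto)
  moreover have "\<forall>x\<in>P. - a \<bullet> x \<le> 1"
  proof
    fix x assume "x \<in> P"
    then have "a \<bullet> (- x) \<le> 1"
      using a neg unfolding facet_normals_def by blast
    then show "- a \<bullet> x \<le> 1"
      by simp
  qed
  ultimately show ?thesis
    by (simp add: facet_normals_def)
qed

section \<open>The norm as a maximum of linear forms\<close>

lemma inner_facet_normal_le_poly_norm:
  assumes P: "symmetric_polytope2 P" and a: "a \<in> facet_normals P"
  shows "a \<bullet> d \<le> poly_norm P d"
proof -
  obtain e where e: "e > 0" "ball 0 e \<subseteq> P"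
    using symmetric_polytope2_zero_interior[OF P] by (meson mem_interior)
  \<comment> \<open>The set whose infimum defines the norm must be nonempty for
    \<open>cInf_greatest\<close>; it is, because \<open>P\<close> contains a ball around 0.\<close>
  have "\<exists>l\<ge>0. d \<in> (*\<^sub>R) l ` P"
  proof (cases "d = 0")
    case True
    moreover have "0 \<in> P"
      using e by auto
    ultimately show ?thesis
      by (intro exI[of _ 0]) (auto intro: image_eqI[of _ _ 0])
  next
    case False
    have "(e / 2 / norm d) *\<^sub>R d \<in> P"
      using e False by (intro subsetD[OF e(2)]) (auto simp: dist_norm)
    moreover have "d = (2 * norm d / e) *\<^sub>R ((e / 2 / norm d) *\<^sub>R d)"
      using e False by simp
    ultimately show ?thesis
      using e by (metis divide_nonneg_pos image_eqI mult_nonneg_nonneg norm_ge_zero zero_le_numeral)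
  qed
  moreover have "a \<bullet> d \<le> l" if "l \<ge> 0" "d \<in> (*\<^sub>R) l ` P" for l
    using that a by (auto simp: facet_normals_def intro!: mult_left_le)
  ultimately show ?thesis
    unfolding poly_norm_def by (intro cInf_greatest) auto
qed

lemma poly_norm_le:
  assumes "l \<ge> 0" "d \<in> (*\<^sub>R) l ` P"
  shows "poly_norm P d \<le> l"
  unfolding poly_norm_def
proof (rule cInf_lower)
  show "l \<in> {l. 0 \<le> l \<and> d \<in> (*\<^sub>R) l ` P}"
    using assms by blast
  show "bdd_below {l. 0 \<le> l \<and> d \<in> (*\<^sub>R) l ` P}"
    by (rule bdd_belowI[of _ 0]) blast
qed

text \<open>Dividing by the total weight turns the combination into a convex one; the weight is
  positive because \<open>d\<close> is nonzero.\<close>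

lemma nonneg_combinations_scaled:
  assumes F: "convex F" and d: "d \<in> nonneg_combinations F" "d \<noteq> 0"
  shows "\<exists>l>0. d \<in> (*\<^sub>R) l ` F"
proof -
  obtain S c where S: "finite S" "S \<subseteq> F" "\<forall>x\<in>S. 0 \<le> (c x :: real)" "d = (\<Sum>x\<in>S. c x *\<^sub>R x)"
    using d(1) by (auto simp: nonneg_combinations_def)
  define l where "l = sum c S"
  have "l \<noteq> 0"
    using S d(2) sum_nonneg_eq_0_iff[of S c] by (auto simp: l_def)
  moreover have "l \<ge> 0"
    using S by (auto simp: l_def sum_nonneg)
  ultimately have l: "l > 0"
    by simp
  have "(\<Sum>x\<in>S. (c x / l) *\<^sub>R x) \<in> F"
    using S l F by (intro convex_sum) (auto simp: l_def sum_divide_distrib[symmetric])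
  moreover have "d = l *\<^sub>R (\<Sum>x\<in>S. (c x / l) *\<^sub>R x)"
    using l by (simp add: S scaleR_sum_right)
  ultimately show ?thesis
    using l by blast
qed

lemma scaleR_nonneg_combinations:
  assumes "y \<in> F" "l \<ge> 0"
  shows "l *\<^sub>R y \<in> nonneg_combinations F"
proof -
  have "l *\<^sub>R y = (\<Sum>x\<in>{y}. l *\<^sub>R x)"
    by simp
  moreover have "finite {y}" "{y} \<subseteq> F" "\<forall>x\<in>{y}. 0 \<le> l"
    using assms by auto
  ultimately show ?thesis
    unfolding nonneg_combinations_def mem_Collect_eq
    by (intro exI[of _ "{y}"] exI[of _ "\<lambda>_. l"] conjI)
qed

text \<open>A ray from the interior point 0 leaves the bounded set \<open>P\<close> at a frontier
  point, and the frontier of a full-dimensional polyhedron is the union of its facets.\<close>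

lemma exists_facet_through_ray:
  assumes P: "symmetric_polytope2 P" and d: "d \<noteq> 0"
  shows "\<exists>a\<in>facet_normals P. \<exists>l>0. \<exists>y\<in>P. a \<bullet> y = 1 \<and> d = l *\<^sub>R y"
proof -
  have 0: "0 \<in> interior P"
    by (rule symmetric_polytope2_zero_interior[OF P])
  have "bounded P" "polyhedron P"
    using P by (auto simp: symmetric_polytope2_def polytope_imp_bounded polytope_imp_polyhedron)
  then obtain m where m: "m > 0" "m *\<^sub>R d \<in> frontier P"
    using ray_to_frontier[OF _ 0 d] by auto
  have "frontier P = rel_frontier P"
    using 0 rel_interior_nonempty_interior[of P] unfolding frontier_def rel_frontier_def by blast
  then obtain F where F: "F facet_of P" "m *\<^sub>R d \<in> F"
    using m rel_frontier_of_polyhedron[OF \<open>polyhedron P\<close>] by auto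
  then obtain a where "a \<in> facet_normals P" "m *\<^sub>R d \<in> P" "a \<bullet> (m *\<^sub>R d) = 1"
    using facet_normal_exists[OF P F(1)] by blast
  moreover have "d = (1 / m) *\<^sub>R (m *\<^sub>R d)" "1 / m > 0"
    using m by simp_all
  ultimately show ?thesis
    by blast
qed

lemma poly_norm_attained:
  assumes P: "symmetric_polytope2 P" and d: "d \<noteq> 0"
  shows "\<exists>a\<in>facet_normals P. a \<bullet> d = poly_norm P d"
proof -
  obtain a l y where *: "a \<in> facet_normals P" "l > 0" "y \<in> P" "a \<bullet> y = 1" "d = l *\<^sub>R y"
    using exists_facet_through_ray[OF P d] by blast
  then have "poly_norm P d \<le> a \<bullet> d"
    using poly_norm_le[of l d P] by simp
  then show ?thesis
    using inner_facet_normal_le_poly_norm[OF P *(1), of d] * by force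
qed

lemma mem_cone_facet_iff:
  assumes P: "symmetric_polytope2 P" and a: "a \<in> facet_normals P" and d: "d \<noteq> 0"
  shows "d \<in> nonneg_combinations {x \<in> P. a \<bullet> x = 1} \<longleftrightarrow> a \<bullet> d = poly_norm P d"
proof
  assume "d \<in> nonneg_combinations {x \<in> P. a \<bullet> x = 1}"
  moreover have "convex {x \<in> P. a \<bullet> x = 1}"
    using a by (auto simp: facet_normals_def facet_of_def dest: face_of_imp_convex)
  ultimately obtain l y where "l > 0" "y \<in> P" "a \<bullet> y = 1" "d = l *\<^sub>R y"
    using nonneg_combinations_scaled d by blast
  then show "a \<bullet> d = poly_norm P d"
    using poly_norm_le[of l d P] inner_facet_normal_le_poly_norm[OF P a, of d] by simp
next
  assume eq: "a \<bullet> d = poly_norm P d"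
  \<comment> \<open>The ray through \<open>d\<close> leaves \<open>P\<close> at \<open>y\<close>, on
    the facet of \<open>b\<close>. Since \<open>a\<close> does at least as well as \<open>b\<close>
    on \<open>d\<close>, it also reaches its bound 1 at \<open>y\<close>.\<close>
  obtain b l y where *: "b \<in> facet_normals P" "l > 0" "y \<in> P" "b \<bullet> y = 1" "d = l *\<^sub>R y"
    using exists_facet_through_ray[OF P d] by blast
  have "b \<bullet> d \<le> a \<bullet> d"
    using eq inner_facet_normal_le_poly_norm[OF P *(1), of d] by simp
  then have "1 \<le> a \<bullet> y"
    using * by simp
  moreover have "a \<bullet> y \<le> 1"
    using a *(3) by (auto simp: facet_normals_def)
  ultimately have "y \<in> {x \<in> P. a \<bullet> x = 1}"
    using * by auto
  then show "d \<in> nonneg_combinations {x \<in> P. a \<bullet> x = 1}"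
    using scaleR_nonneg_combinations * by simp
qed

section \<open>Directions in the interior of a facet cone\<close>

text \<open>Finitely many strict linear inequalities, hence an open condition on \<open>d\<close>:
  the form \<open>a\<close> is the only maximiser. That \<open>d\<close> is nonzero need not be
  demanded, because it follows.\<close>

definition in_facet_cone :: "(real^2) set \<Rightarrow> real^2 \<Rightarrow> real^2 \<Rightarrow> bool" where
  "in_facet_cone P a d \<longleftrightarrow>
     a \<in> facet_normals P \<and> (\<forall>b\<in>facet_normals P. b \<noteq> a \<longrightarrow> b \<bullet> d < a \<bullet> d)"

text \<open>At 0 all forms tie, and \<open>- a\<close> is a normal different from
  \<open>a\<close>.\<close>

lemma in_facet_cone_nonzero:
  assumes "symmetric_polytope2 P" "in_facet_cone P a d"
  shows "d \<noteq> 0"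
proof
  assume "d = 0"
  moreover have "- a \<in> facet_normals P" "a \<noteq> 0"
    using assms facet_normals_uminus facet_normals_nonzero[of a P]
    by (auto simp: in_facet_cone_def)
  moreover have "- a \<noteq> a"
  proof
    assume "- a = a"
    from arg_cong[OF this, of "inner a"] show False
      using \<open>a \<noteq> 0\<close> by simp
  qed
  ultimately show False
    using assms(2) unfolding in_facet_cone_def by (metis inner_zero_right less_irrefl)
qed

lemma in_facet_cone_uminus:
  assumes P: "symmetric_polytope2 P" and a: "in_facet_cone P a d"
  shows "in_facet_cone P (- a) (- d)"
  unfolding in_facet_cone_def
proof (intro conjI ballI impI)
  show "- a \<in> facet_normals P"
    using a facet_normals_uminus[OF P] by (simp add: in_facet_cone_def)
  fix b assume "b \<in> facet_normals P" "b \<noteq> - a"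
  then have "- b \<in> facet_normals P" "- b \<noteq> a"
    using facet_normals_uminus[OF P] by auto
  then have "(- b) \<bullet> d < a \<bullet> d"
    using a by (auto simp: in_facet_cone_def)
  then show "b \<bullet> - d < - a \<bullet> - d"
    by simp
qed

lemma in_facet_cone_scaleR:
  assumes "in_facet_cone P a d" "l > 0"
  shows "in_facet_cone P a (l *\<^sub>R d)"
  using assms by (simp add: in_facet_cone_def)

lemma poly_norm_in_facet_cone:
  assumes P: "symmetric_polytope2 P" and a: "in_facet_cone P a d"
  shows "poly_norm P d = a \<bullet> d"
proof -
  obtain b where b: "b \<in> facet_normals P" "b \<bullet> d = poly_norm P d"
    using poly_norm_attained[OF P in_facet_cone_nonzero[OF assms]] by blast
  moreover have "a \<bullet> d \<le> poly_norm P d"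
    using a inner_facet_normal_le_poly_norm[OF P] by (simp add: in_facet_cone_def)
  ultimately show ?thesis
    using a by (force simp: in_facet_cone_def)
qed

text \<open>Facets correspond bijectively to normals, and lying in the cone of a facet means that
  its normal attains the norm. A unique facet is thus a strict maximiser.\<close>

lemma unique_facet_iff_in_facet_cone:
  assumes P: "symmetric_polytope2 P" and d: "d \<noteq> 0"
  shows "(\<exists>!F. F facet_of P \<and> d \<in> nonneg_combinations F) \<longleftrightarrow> (\<exists>a. in_facet_cone P a d)"
proof
  assume L: "\<exists>!F. F facet_of P \<and> d \<in> nonneg_combinations F"
  obtain a where a: "a \<in> facet_normals P" "a \<bullet> d = poly_norm P d"
    using poly_norm_attained[OF P d] by blast
  have "b \<bullet> d < a \<bullet> d" if b: "b \<in> facet_normals P" "b \<noteq> a" for b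
  proof (rule ccontr)
    assume "\<not> b \<bullet> d < a \<bullet> d"
    then have "b \<bullet> d = poly_norm P d"
      using a inner_facet_normal_le_poly_norm[OF P b(1), of d] by simp
    then have "d \<in> nonneg_combinations {x \<in> P. b \<bullet> x = 1}" "d \<in> nonneg_combinations {x \<in> P. a \<bullet> x = 1}"
      using mem_cone_facet_iff[OF P _ d] a b by auto
    then have "{x \<in> P. a \<bullet> x = 1} = {x \<in> P. b \<bullet> x = 1}"
      using L a b by (auto simp: facet_normals_def)
    then show False
      using facet_normal_unique[OF P] a b by blast
  qed
  then show "\<exists>a. in_facet_cone P a d"
    using a unfolding in_facet_cone_def by blast
next
  assume "\<exists>a. in_facet_cone P a d"
  then obtain a where a: "in_facet_cone P a d"
    by blast
  then have aN: "a \<in> facet_normals P"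
    by (simp add: in_facet_cone_def)
  show "\<exists>!F. F facet_of P \<and> d \<in> nonneg_combinations F"
  proof (rule ex1I)
    show "{x \<in> P. a \<bullet> x = 1} facet_of P \<and> d \<in> nonneg_combinations {x \<in> P. a \<bullet> x = 1}"
      using aN mem_cone_facet_iff[OF P aN d] poly_norm_in_facet_cone[OF P a]
      by (simp add: facet_normals_def)
  next
    fix F assume F: "F facet_of P \<and> d \<in> nonneg_combinations F"
    then obtain b where b: "b \<in> facet_normals P" "F = {x \<in> P. b \<bullet> x = 1}"
      using facet_normal_exists[OF P] by blast
    then have "b \<bullet> d = a \<bullet> d"
      using F mem_cone_facet_iff[OF P b(1) d] poly_norm_in_facet_cone[OF P a] by simp
    then have "b = a"
      using a b by (force simp: in_facet_cone_def)
    then show "F = {x \<in> P. a \<bullet> x = 1}"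
      using b by simp
  qed
qed

text \<open>The filter is left general because the lemma serves both flexes (\<open>at 0\<close>)
  and the shrinking of the \<open>K4\<close> (\<open>at_right 0\<close>).\<close>

lemma eventually_in_facet_cone:
  assumes P: "symmetric_polytope2 P" and a: "in_facet_cone P a d"
    and h: "(h \<longlongrightarrow> d) F"
  shows "eventually (\<lambda>t. in_facet_cone P a (h t)) F"
proof -
  have "eventually (\<lambda>t. b \<noteq> a \<longrightarrow> b \<bullet> h t < a \<bullet> h t) F" if "b \<in> facet_normals P" for b
  proof (cases "b = a")
    case False
    have "((\<lambda>t. b \<bullet> h t - a \<bullet> h t) \<longlongrightarrow> b \<bullet> d - a \<bullet> d) F"
      by (intro tendsto_intros h)
    moreover have "b \<bullet> d - a \<bullet> d < 0"
      using a that False by (simp add: in_facet_cone_def)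
    ultimately have "eventually (\<lambda>t. b \<bullet> h t - a \<bullet> h t < 0) F"
      by (rule order_tendstoD)
    then show ?thesis
      by eventually_elim simp
  qed simp
  then have "eventually (\<lambda>t. \<forall>b\<in>facet_normals P. b \<noteq> a \<longrightarrow> b \<bullet> h t < a \<bullet> h t) F"
    by (intro eventually_ball_finite finite_facet_normals[OF P]) auto
  then show ?thesis
    using a by (simp add: in_facet_cone_def)
qed

text \<open>Near \<open>x - y\<close> the norm is the form \<open>a\<close>, so for small
  \<open>t\<close> the difference is exactly \<open>a \<bullet> (u - v)\<close> times
  \<open>t\<close>, which is \<open>o(t)\<close> only if the slope vanishes.\<close>

lemma poly_norm_flex_iff:
  assumes P: "symmetric_polytope2 P" and a: "in_facet_cone P a (x - y)"
  shows "(\<lambda>t::real. poly_norm P ((x + t *\<^sub>R u) - (y + t *\<^sub>R v)) - poly_norm P (x - y)) \<in> o[at 0](\<lambda>t. t)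
    \<longleftrightarrow> a \<bullet> (u - v) = 0"
proof -
  have lim: "((\<lambda>t::real. (x + t *\<^sub>R u) - (y + t *\<^sub>R v)) \<longlongrightarrow> x - y) (at 0)"
    by (auto intro!: tendsto_eq_intros)
  have "eventually (\<lambda>t::real. poly_norm P ((x + t *\<^sub>R u) - (y + t *\<^sub>R v)) - poly_norm P (x - y)
      = (a \<bullet> (u - v)) * t) (at 0)"
    using eventually_in_facet_cone[OF P a lim]
    by eventually_elim
      (simp add: poly_norm_in_facet_cone[OF P] poly_norm_in_facet_cone[OF P a] algebra_simps)
  then have "(\<lambda>t::real. poly_norm P ((x + t *\<^sub>R u) - (y + t *\<^sub>R v)) - poly_norm P (x - y)) \<in> o[at 0](\<lambda>t. t)
      \<longleftrightarrow> (\<lambda>t::real. (a \<bullet> (u - v)) * t) \<in> o[at 0](\<lambda>t. t)"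
    by (rule landau_o.small.in_cong)
  also have "\<dots> \<longleftrightarrow> a \<bullet> (u - v) = 0"
  proof
    assume small: "(\<lambda>t::real. (a \<bullet> (u - v)) * t) \<in> o[at 0](\<lambda>t. t)"
    show "a \<bullet> (u - v) = 0"
    proof (rule ccontr)
      assume nz: "a \<bullet> (u - v) \<noteq> 0"
      then have "(\<lambda>t::real. t) \<in> o[at 0](\<lambda>t. t)"
        using small by simp
      then have "eventually (\<lambda>t::real. t = 0) (at 0)"
        by (simp add: landau_o.small_refl_iff)
      moreover have "eventually (\<lambda>t::real. t \<noteq> 0) (at 0)"
        by (rule eventually_neq_at_within)
      ultimately have "eventually (\<lambda>t::real. False) (at 0)"
        by eventually_elim simp
      then show False
        by simp
    qed
  qed simp
  finally show ?thesis .
qed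

section \<open>A rigid placement of the complete graph on four vertices\<close>

text \<open>Otherwise the closed sets on which the different forms are maximal would be disjoint
  away from 0 and would split the punctured plane, which is connected.\<close>

lemma exists_direction_with_two_normals:
  assumes P: "symmetric_polytope2 P"
  shows "\<exists>x a b. a \<in> facet_normals P \<and> b \<in> facet_normals P \<and> a \<noteq> b \<and> x \<noteq> 0 \<and>
    a \<bullet> x = poly_norm P x \<and> b \<bullet> x = poly_norm P x"
proof (rule ccontr)
  assume "\<not> ?thesis"
  then have uniq: "a = b" if "a \<in> facet_normals P" "b \<in> facet_normals P" "x \<noteq> 0"
    "a \<bullet> x = poly_norm P x" "b \<bullet> x = poly_norm P x" for a b x
    using that by blast
  define U where "U a = {x. \<forall>b\<in>facet_normals P. b \<bullet> x \<le> a \<bullet> x}" for a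
  have U: "a \<bullet> x = poly_norm P x" if "a \<in> facet_normals P" "x \<in> U a" "x \<noteq> 0" for a x
    using that poly_norm_attained[OF P] inner_facet_normal_le_poly_norm[OF P that(1), of x]
    by (force simp: U_def)
  have cover: "\<exists>a\<in>facet_normals P. x \<in> U a" if "x \<noteq> 0" for x
    using poly_norm_attained[OF P that] inner_facet_normal_le_poly_norm[OF P, of _ x]
    by (force simp: U_def)
  have "closed (U a)" for a
  proof -
    have "U a = (\<Inter>b\<in>facet_normals P. {x. b \<bullet> x \<le> a \<bullet> x})"
      by (auto simp: U_def)
    then show ?thesis
      by (auto intro!: closed_INT closed_Collect_le continuous_intros)
  qed
  have "axis 1 1 \<noteq> (0::real^2)"
    by (simp add: axis_eq_0_iff)
  then obtain x :: "real^2" where x: "x \<noteq> 0"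
    by blast
  obtain a where a: "a \<in> facet_normals P" "x \<in> U a"
    using cover[OF x] by blast
  obtain b where b: "b \<in> facet_normals P" "- x \<in> U b"
    using cover[of "- x"] x by auto
  \<comment> \<open>A form maximal at both \<open>x\<close> and \<open>- x\<close> would, compared
    with \<open>- a\<close>, vanish at \<open>x\<close>; the norm of \<open>x\<close> would then be
    0.\<close>
  have "b \<noteq> a"
  proof
    assume "b = a"
    moreover have "- a \<in> facet_normals P"
      using facet_normals_uminus[OF P a(1)] .
    ultimately have "(- a) \<bullet> x \<le> a \<bullet> x" "(- a) \<bullet> (- x) \<le> a \<bullet> (- x)"
      using a b by (auto simp: U_def)
    then have "a \<bullet> x = 0" "a \<bullet> (- x) = 0"
      by simp_all
    then have "poly_norm P x = 0"
      using U[OF a x] by simp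
    obtain c l y where *: "c \<in> facet_normals P" "l > 0" "y \<in> P" "c \<bullet> y = 1" "x = l *\<^sub>R y"
      using exists_facet_through_ray[OF P x] by blast
    then show False
      using inner_facet_normal_le_poly_norm[OF P *(1), of x] \<open>poly_norm P x = 0\<close> by simp
  qed
  define B where "B = (\<Union>c\<in>facet_normals P - {a}. U c)"
  have "closed B"
    unfolding B_def using finite_facet_normals[OF P] \<open>\<And>a. closed (U a)\<close> by (intro closed_UN) auto
  moreover have "- {0} \<subseteq> U a \<union> B"
    using cover by (auto simp: B_def)
  moreover have "U a \<inter> B \<inter> - {0} = {}"
  proof -
    have "c = a" if "c \<in> facet_normals P" "y \<in> U a" "y \<in> U c" "y \<noteq> 0" for c y
      using uniq[OF that(1) a(1) that(4)] U[OF that(1,3,4)] U[OF a(1) that(2,4)] by simp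
    then show ?thesis
      by (auto simp: B_def)
  qed
  moreover have "U a \<inter> - {0} \<noteq> {}" "B \<inter> - {0} \<noteq> {}"
    using a b x \<open>b \<noteq> a\<close> by (auto simp: B_def)
  ultimately have "\<not> connected (- {0::real^2})"
    unfolding connected_closed using \<open>\<And>a. closed (U a)\<close> by blast
  then show False
    by (simp add: connected_punctured_universe)
qed

text \<open>
  \<open>x\<close> spans a common ray of the cones of two adjacent facets, and \<open>z\<close> is orthogonal to it.
\<close>

lemma exists_adjacent_facet_cones:
  assumes P: "symmetric_polytope2 P"
  shows "\<exists>a b x z e. e > 0 \<and> (\<forall>u. a \<bullet> u = 0 \<and> b \<bullet> u = 0 \<longrightarrow> u = 0) \<and>
    (\<forall>t. 0 < t \<and> t < e \<longrightarrow> in_facet_cone P a (x + t *\<^sub>R z) \<and> in_facet_cone P b (x - t *\<^sub>R z))"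
proof -
  obtain x a0 b0 where ab0: "a0 \<in> facet_normals P" "b0 \<in> facet_normals P" "a0 \<noteq> b0" "x \<noteq> 0"
    "a0 \<bullet> x = poly_norm P x" "b0 \<bullet> x = poly_norm P x"
    using exists_direction_with_two_normals[OF P] by metis
  \<comment> \<open>\<open>z\<close> is \<open>x\<close> turned by a right angle; having the same
    length, it allows the one factor \<open>x \<bullet> x\<close> in \<open>decomp\<close>.\<close>
  define z :: "real^2" where "z = vector [- x$2, x$1]"
  have decomp: "(x \<bullet> x) *\<^sub>R u = (u \<bullet> x) *\<^sub>R x + (u \<bullet> z) *\<^sub>R z" for u
    by (simp add: z_def vec_eq_iff forall_2 inner_vec_def sum_2 algebra_simps)
  have determined: "u = 0" if "u \<bullet> x = 0" "u \<bullet> z = 0" for u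
    using decomp[of u] that ab0 by simp
  define A where "A = {a \<in> facet_normals P. a \<bullet> x = poly_norm P x}"
  have finA: "finite A" and A0: "a0 \<in> A" "b0 \<in> A"
    using finite_facet_normals[OF P] ab0 by (auto simp: A_def)
  have inj: "c = d" if "c \<in> A" "d \<in> A" "c \<bullet> z = d \<bullet> z" for c d
    using determined[of "c - d"] that by (simp add: A_def inner_diff_left)
  have top: "\<exists>a\<in>A. (\<forall>c\<in>A. c \<bullet> w \<le> a \<bullet> w)" for w
  proof -
    have "Max ((\<lambda>c. c \<bullet> w) ` A) \<in> (\<lambda>c. c \<bullet> w) ` A"
      using finA A0 by (intro Max_in) auto
    then obtain a where "a \<in> A" "a \<bullet> w = Max ((\<lambda>c. c \<bullet> w) ` A)"
      by auto
    then show ?thesis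
      using finA by (auto intro!: bexI[of _ a])
  qed
  \<comment> \<open>The forms in \<open>A\<close> tie at \<open>x\<close>, so their values on
    \<open>w\<close> decide; every other form is strictly smaller at \<open>x\<close> and stays so
    for small \<open>t\<close>.\<close>
  have cone: "\<exists>e>0. \<forall>t. 0 < t \<and> t < e \<longrightarrow> in_facet_cone P a (x + t *\<^sub>R w)"
    if a: "a \<in> A" and lt: "\<And>c. c \<in> A \<Longrightarrow> c \<noteq> a \<Longrightarrow> c \<bullet> w < a \<bullet> w" for a w
  proof -
    have "eventually (\<lambda>t. c \<noteq> a \<longrightarrow> c \<bullet> (x + t *\<^sub>R w) < a \<bullet> (x + t *\<^sub>R w)) (at_right 0)"
      if c: "c \<in> facet_normals P" for c
    proof (cases "c \<in> A")
      case True
      have "eventually (\<lambda>t::real. 0 < t) (at_right 0)"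
        by (simp add: eventually_at_right_less)
      then show ?thesis
        by eventually_elim (use True a lt in \<open>auto simp: A_def inner_add_right\<close>)
    next
      case False
      then have "c \<bullet> x < a \<bullet> x"
        using c a inner_facet_normal_le_poly_norm[OF P c, of x] by (simp add: A_def)
      moreover have "((\<lambda>t. c \<bullet> (x + t *\<^sub>R w) - a \<bullet> (x + t *\<^sub>R w)) \<longlongrightarrow> c \<bullet> x - a \<bullet> x) (at_right 0)"
        by (auto intro!: tendsto_eq_intros)
      ultimately have "eventually (\<lambda>t. c \<bullet> (x + t *\<^sub>R w) - a \<bullet> (x + t *\<^sub>R w) < 0) (at_right 0)"
        by (intro order_tendstoD) auto
      then show ?thesis
        by eventually_elim simp
    qed
    then have "eventually (\<lambda>t. \<forall>c\<in>facet_normals P. c \<noteq> a \<longrightarrow> c \<bullet> (x + t *\<^sub>R w) < a \<bullet> (x + t *\<^sub>R w)) (at_right 0)"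
      by (intro eventually_ball_finite finite_facet_normals[OF P]) auto
    then have "eventually (\<lambda>t. in_facet_cone P a (x + t *\<^sub>R w)) (at_right 0)"
      using a by (simp add: in_facet_cone_def A_def)
    then show ?thesis
      by (auto simp: eventually_at_right_field)
  qed
  \<comment> \<open>The forms in \<open>A\<close> are ordered by their values on \<open>z\<close>.
    The two extremes win on the two sides of the ray of \<open>x\<close>.\<close>
  obtain a where a: "a \<in> A" "\<forall>c\<in>A. c \<bullet> z \<le> a \<bullet> z"
    using top by blast
  obtain b where b: "b \<in> A" "\<forall>c\<in>A. c \<bullet> (- z) \<le> b \<bullet> (- z)"
    using top by blast
  have a_lt: "c \<bullet> z < a \<bullet> z" if "c \<in> A" "c \<noteq> a" for c
    using a that inj[of c a] by force
  have b_lt: "c \<bullet> (- z) < b \<bullet> (- z)" if "c \<in> A" "c \<noteq> b" for c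
    using b that inj[of c b] by force
  have "a \<bullet> z \<noteq> b \<bullet> z"
  proof
    assume eq: "a \<bullet> z = b \<bullet> z"
    then have "c \<bullet> z = a \<bullet> z" if "c \<in> A" for c
      using a b that by force
    then show False
      using inj[OF A0] A0 ab0 by simp
  qed
  obtain e1 where e1: "e1 > 0" "\<forall>t. 0 < t \<and> t < e1 \<longrightarrow> in_facet_cone P a (x + t *\<^sub>R z)"
    using cone[OF a(1) a_lt] by blast
  obtain e2 where e2: "e2 > 0" "\<forall>t. 0 < t \<and> t < e2 \<longrightarrow> in_facet_cone P b (x + t *\<^sub>R (- z))"
    using cone[OF b(1) b_lt] by blast
  have norm_pos: "poly_norm P x \<noteq> 0"
  proof -
    obtain c l y where *: "c \<in> facet_normals P" "l > 0" "y \<in> P" "c \<bullet> y = 1" "x = l *\<^sub>R y"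
      using exists_facet_through_ray[OF P ab0(4)] by blast
    then show ?thesis
      using inner_facet_normal_le_poly_norm[OF P *(1), of x] by simp
  qed
  \<comment> \<open>Pairing \<open>decomp\<close> with \<open>a\<close> and with \<open>b\<close>
    gives two equations with the same first term; their difference isolates
    \<open>u \<bullet> z\<close>.\<close>
  have "u = 0" if u: "a \<bullet> u = 0" "b \<bullet> u = 0" for u
  proof (rule determined)
    have eq: "(u \<bullet> x) * poly_norm P x + (u \<bullet> z) * (c \<bullet> z) = 0" if "c \<in> A" "c \<bullet> u = 0" for c
      using arg_cong[OF decomp[of u], of "\<lambda>v. c \<bullet> v"] that by (simp add: A_def inner_add_right)
    have "(u \<bullet> z) * (a \<bullet> z - b \<bullet> z) = 0"
      using eq[OF a(1) u(1)] eq[OF b(1) u(2)] by (simp only: right_diff_distrib)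
    then show *: "u \<bullet> z = 0"
      using \<open>a \<bullet> z \<noteq> b \<bullet> z\<close> by simp
    show "u \<bullet> x = 0"
      using eq[OF a(1) u(1)] * norm_pos by simp
  qed
  then show ?thesis
    using e1 e2 by (intro exI[of _ a] exI[of _ b] exI[of _ x] exI[of _ z] exI[of _ "min e1 e2"]) auto
qed

text \<open>
  The four points lie near a line spanned by \<open>x\<close>, their offsets being the simple permutation
  2, 4, 1, 3. Its non-inversions and its inversions both form a path on the four points,
  so that each of the two facets induces a spanning tree.
\<close>

lemma exists_rigid_K4_placement:
  assumes P: "symmetric_polytope2 P"
  shows "\<exists>a b q0 q1 q2 q3. (\<forall>u. a \<bullet> u = 0 \<and> b \<bullet> u = 0 \<longrightarrow> u = 0) \<and>
    in_facet_cone P a (q1 - q0) \<and> in_facet_cone P a (q3 - q0) \<and> in_facet_cone P a (q3 - q2) \<and>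
    in_facet_cone P b (q2 - q0) \<and> in_facet_cone P b (q2 - q1) \<and> in_facet_cone P b (q3 - q1)"
proof -
  obtain a b x z e where e: "e > 0" and ind: "\<forall>u. a \<bullet> u = 0 \<and> b \<bullet> u = 0 \<longrightarrow> u = 0"
    and cones: "\<And>t. 0 < t \<Longrightarrow> t < e \<Longrightarrow> in_facet_cone P a (x + t *\<^sub>R z)"
      "\<And>t. 0 < t \<Longrightarrow> t < e \<Longrightarrow> in_facet_cone P b (x - t *\<^sub>R z)"
    using exists_adjacent_facet_cones[OF P] by metis
  \<comment> \<open>The steepest of the six pairs, \<open>q 1 4\<close> and \<open>q 2 1\<close>,
    changes its offset by 3 over a unit step along \<open>x\<close>. The factor \<open>e / 4\<close>
    keeps every slope below \<open>e\<close>.\<close>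
  define r where "r = e / 4"
  define q where "q s t = s *\<^sub>R x + (t * r) *\<^sub>R z" for s t
  have a: "in_facet_cone P a (q s' t' - q s t)" if "s < s'" "t < t'" "t' - t < 4 * (s' - s)" for s s' t t'
  proof -
    have "q s' t' - q s t = (s' - s) *\<^sub>R x + ((t' - t) * r) *\<^sub>R z"
      by (simp add: q_def algebra_simps)
    then have "q s' t' - q s t = (s' - s) *\<^sub>R (x + ((t' - t) * r / (s' - s)) *\<^sub>R z)"
      using that by (simp add: scaleR_add_right)
    moreover have "0 < (t' - t) * r / (s' - s)" "(t' - t) * r / (s' - s) < e"
      using that e mult_strict_left_mono[OF that(3) e] by (auto simp: r_def field_simps)
    ultimately show ?thesis
      using that by (simp add: cones in_facet_cone_scaleR)
  qed
  have b: "in_facet_cone P b (q s' t' - q s t)" if "s < s'" "t > t'" "t - t' < 4 * (s' - s)" for s s' t t'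
  proof -
    have "q s' t' - q s t = (s' - s) *\<^sub>R x - ((t - t') * r) *\<^sub>R z"
      by (simp add: q_def algebra_simps)
    then have "q s' t' - q s t = (s' - s) *\<^sub>R (x - ((t - t') * r / (s' - s)) *\<^sub>R z)"
      using that by (simp add: scaleR_diff_right)
    moreover have "0 < (t - t') * r / (s' - s)" "(t - t') * r / (s' - s) < e"
      using that e mult_strict_left_mono[OF that(3) e] by (auto simp: r_def field_simps)
    ultimately show ?thesis
      using that by (simp add: cones in_facet_cone_scaleR)
  qed
  show ?thesis
    by (rule exI[of _ a], rule exI[of _ b], rule exI[of _ "q 0 2"], rule exI[of _ "q 1 4"],
        rule exI[of _ "q 2 1"], rule exI[of _ "q 3 3"]) (use ind in \<open>auto intro!: a b\<close>)
qed

section \<open>The vertex-to-\<open>K\<^sub>4\<close> move\<close>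

text \<open>The requirement that adjacent points differ is absorbed, since
  \<open>in_facet_cone\<close> excludes the zero vector.\<close>

lemma well_positioned_framework_iff:
  assumes P: "symmetric_polytope2 P" and E: "simple_graph V E"
  shows "framework V E p \<and> well_positioned P E p \<longleftrightarrow>
    (\<forall>v w. {v, w} \<in> E \<longrightarrow> (\<exists>a. in_facet_cone P a (p v - p w)))"
proof
  assume wp: "framework V E p \<and> well_positioned P E p"
  show "\<forall>v w. {v, w} \<in> E \<longrightarrow> (\<exists>a. in_facet_cone P a (p v - p w))"
  proof (intro allI impI)
    fix v w assume "{v, w} \<in> E"
    then show "\<exists>a. in_facet_cone P a (p v - p w)"
      using wp unique_facet_iff_in_facet_cone[OF P, of "p v - p w"]
      by (simp add: framework_def well_positioned_def)
  qed
next
  assume R: "\<forall>v w. {v, w} \<in> E \<longrightarrow> (\<exists>a. in_facet_cone P a (p v - p w))"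
  then have nz: "p v - p w \<noteq> 0" if "{v, w} \<in> E" for v w
    using that in_facet_cone_nonzero[OF P] by blast
  then show "framework V E p \<and> well_positioned P E p"
    using R E unique_facet_iff_in_facet_cone[OF P nz]
    by (auto simp: framework_def well_positioned_def)
qed

lemma simple_graph_edge:
  assumes "simple_graph V E" "{v, w} \<in> E"
  shows "v \<in> V" "w \<in> V" "v \<noteq> w"
proof -
  obtain x y where "x \<in> V" "y \<in> V" "x \<noteq> y" "{v, w} = {x, y}"
    using assms unfolding simple_graph_def by blast
  then show "v \<in> V" "w \<in> V" "v \<noteq> w"
    by (auto simp: doubleton_eq_iff)
qed

theorem proposition4p8:
  fixes P :: "(real^2) set"
    and V V' :: "'a set" and E E' :: "'a set set"
    and p :: "'a \<Rightarrow> real^2"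
  assumes "symmetric_polytope2 P"
    and "finite V"
    and "framework V E p"
    and "well_positioned P E p"
    and "infinitesimally_rigid P V E p"
    and "vertex_to_K4_move V E V' E'"
  shows "\<exists>p'. framework V' E' p' \<and> well_positioned P E' p' \<and> infinitesimally_rigid P V' E' p'"
proof -
  note P = assms(1)
  obtain v0 v1 v2 v3 f where v: "v0 \<in> V" "v1 \<notin> V" "v2 \<notin> V" "v3 \<notin> V" "distinct [v1, v2, v3]"
    and f: "\<forall>w. {v0, w} \<in> E \<longrightarrow> f w \<in> {v0, v1, v2, v3}"
    and V': "V' = V \<union> {v1, v2, v3}"
    and E': "E' = {e \<in> E. v0 \<notin> e} \<union> {{f w, w} |w. {v0, w} \<in> E} \<union>
             {{v0, v1}, {v0, v2}, {v0, v3}, {v1, v2}, {v1, v3}, {v2, v3}}"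
    using assms(6) unfolding vertex_to_K4_move_def by (elim exE conjE) (rule that; assumption)
  note f = f[rule_format]
  have graph: "simple_graph V E"
    using assms(3) by (simp add: framework_def)
  note edge = simple_graph_edge[OF graph]
  have dist: "v0 \<noteq> v1" "v0 \<noteq> v2" "v0 \<noteq> v3" "v1 \<noteq> v2" "v1 \<noteq> v3" "v2 \<noteq> v3"
    using v by auto
  have old: "\<exists>a. in_facet_cone P a (p v - p w)" if "{v, w} \<in> E" for v w
    using that assms(3,4) well_positioned_framework_iff[OF P graph] by blast
  then obtain n where n: "\<And>w. {v0, w} \<in> E \<Longrightarrow> in_facet_cone P (n w) (p v0 - p w)"
    by metis
  obtain a b q0 q1 q2 q3 where ind: "\<And>u. a \<bullet> u = 0 \<Longrightarrow> b \<bullet> u = 0 \<Longrightarrow> u = 0"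
    and a: "in_facet_cone P a (q1 - q0)" "in_facet_cone P a (q3 - q0)" "in_facet_cone P a (q3 - q2)"
    and b: "in_facet_cone P b (q2 - q0)" "in_facet_cone P b (q2 - q1)" "in_facet_cone P b (q3 - q1)"
    using exists_rigid_K4_placement[OF P] by metis
  \<comment> \<open>The default value \<open>q0\<close> is the one meant for \<open>v0\<close>;
    \<open>q\<close> is used only on the four vertices of the \<open>K4\<close>.\<close>
  define q where "q x = (if x = v1 then q1 else if x = v2 then q2 else if x = v3 then q3 else q0)" for x
  \<comment> \<open>A small enough shift of the end at \<open>v0\<close> leaves the edge in its open
    cone. As \<open>V\<close> is finite, one \<open>r\<close> serves all neighbours.\<close>
  have "eventually (\<lambda>r. {v0, w} \<in> E \<longrightarrow> in_facet_cone P (n w) (p v0 + r *\<^sub>R q (f w) - p w)) (at_right 0)" for w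
  proof (cases "{v0, w} \<in> E")
    case True
    have "((\<lambda>r. p v0 + r *\<^sub>R q (f w) - p w) \<longlongrightarrow> p v0 - p w) (at_right 0)"
      by (auto intro!: tendsto_eq_intros)
    then show ?thesis
      using eventually_in_facet_cone[OF P n[OF True]] by (simp add: True)
  qed simp
  then have "eventually (\<lambda>r. \<forall>w\<in>V. {v0, w} \<in> E \<longrightarrow>
      in_facet_cone P (n w) (p v0 + r *\<^sub>R q (f w) - p w)) (at_right 0)"
    by (intro eventually_ball_finite assms(2)) blast
  moreover have "eventually (\<lambda>r::real. 0 < r) (at_right 0)"
    by (simp add: eventually_at_right_less)
  ultimately have "eventually (\<lambda>r. 0 < r \<and> (\<forall>w\<in>V. {v0, w} \<in> E \<longrightarrow>
      in_facet_cone P (n w) (p v0 + r *\<^sub>R q (f w) - p w))) (at_right 0)"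
    by eventually_elim simp
  then obtain r where r: "r > 0" and "\<forall>w\<in>V. {v0, w} \<in> E \<longrightarrow>
      in_facet_cone P (n w) (p v0 + r *\<^sub>R q (f w) - p w)"
    using eventually_happens'[OF trivial_limit_at_right_real] by blast
  then have near: "in_facet_cone P (n w) (p v0 + r *\<^sub>R q (f w) - p w)" if "{v0, w} \<in> E" for w
    using that edge(2) by blast
  define p' where "p' x = (if x \<in> {v0, v1, v2, v3} then p v0 + r *\<^sub>R q x else p x)" for x
  have p'_old: "p' w = p w" if "w \<in> V" "w \<noteq> v0" for w
    using that v by (auto simp: p'_def)
  have K4: "in_facet_cone P c (p' x - p' y)"
    if "x \<in> {v0, v1, v2, v3}" "y \<in> {v0, v1, v2, v3}" "in_facet_cone P c (q x - q y)" for c x y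
  proof -
    have "p' x - p' y = r *\<^sub>R (q x - q y)"
      using that by (simp add: p'_def scaleR_diff_right)
    then show ?thesis
      using in_facet_cone_scaleR[OF that(3) r] by simp
  qed
  have q: "q v0 = q0" "q v1 = q1" "q v2 = q2" "q v3 = q3"
    using dist by (auto simp: q_def)
  have a': "in_facet_cone P a (p' v1 - p' v0)" "in_facet_cone P a (p' v3 - p' v0)"
      "in_facet_cone P a (p' v3 - p' v2)"
    and b': "in_facet_cone P b (p' v2 - p' v0)" "in_facet_cone P b (p' v2 - p' v1)"
      "in_facet_cone P b (p' v3 - p' v1)"
    by (simp_all add: K4 q a b)
  have moved: "in_facet_cone P (n w) (p' (f w) - p' w)" if "{v0, w} \<in> E" for w
    using near[OF that] f[OF that] edge[OF that] p'_old[of w] by (simp add: p'_def)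
  have kept: "p' x - p' y = p x - p y" if "{x, y} \<in> E" "v0 \<noteq> x" "v0 \<noteq> y" for x y
    using that edge[OF that(1)] p'_old by simp
  \<comment> \<open>Edges are unordered, but both differences of their endpoints must be checked;
    reversing an edge replaces its normal by the opposite one.\<close>
  define good where "good x y \<longleftrightarrow> (\<exists>c. in_facet_cone P c (p' x - p' y))" for x y
  have good_sym: "good y x" if "good x y" for x y
    using that in_facet_cone_uminus[OF P, of _ "p' x - p' y"] by (auto simp: good_def)
  have good_edge: "good v w" if "{v, w} = {x, y}" "good x y" for v w x y
    using that good_sym by (auto simp: doubleton_eq_iff)
  have E'_cases: "(e \<in> E \<and> v0 \<notin> e) \<or> (\<exists>w. e = {f w, w} \<and> {v0, w} \<in> E) \<or>
      e \<in> {{v0, v1}, {v0, v2}, {v0, v3}, {v1, v2}, {v1, v3}, {v2, v3}}" if "e \<in> E'" for e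
    using that by (simp only: E' Un_iff mem_Collect_eq disj_assoc)
  have good: "good v w" if vw: "{v, w} \<in> E'" for v w
    using E'_cases[OF vw]
  proof (elim disjE exE conjE)
    assume "{v, w} \<in> E" "v0 \<notin> {v, w}"
    then show ?thesis
      using old[of v w] kept[of v w] by (simp add: good_def)
  next
    fix w' assume w': "{v, w} = {f w', w'}" "{v0, w'} \<in> E"
    have "good (f w') w'"
      using moved[OF w'(2)] good_def by blast
    then show ?thesis
      by (rule good_edge[OF w'(1)])
  next
    assume K: "{v, w} \<in> {{v0, v1}, {v0, v2}, {v0, v3}, {v1, v2}, {v1, v3}, {v2, v3}}"
    have "good v1 v0" "good v2 v0" "good v3 v0" "good v2 v1" "good v3 v1" "good v3 v2"
      using a' b' unfolding good_def by blast+
    note this[THEN good_sym]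
    with K show ?thesis
      by (elim insertE emptyE) (erule good_edge, assumption)+
  qed
  have "simple_graph V' E'"
    unfolding simple_graph_def
  proof
    fix e assume "e \<in> E'"
    have pair: "\<exists>v\<in>V'. \<exists>w\<in>V'. v \<noteq> w \<and> e = {v, w}"
      if "e = {x, y}" "x \<in> V'" "y \<in> V'" "x \<noteq> y" for x y
      using that by blast
    show "\<exists>v\<in>V'. \<exists>w\<in>V'. v \<noteq> w \<and> e = {v, w}"
      using E'_cases[OF \<open>e \<in> E'\<close>]
    proof (elim disjE exE conjE)
      assume "e \<in> E"
      then obtain x y where "x \<in> V" "y \<in> V" "x \<noteq> y" "e = {x, y}"
        using graph unfolding simple_graph_def by blast
      then show ?thesis
        by (intro pair) (simp_all add: V')
    next
      fix w assume w: "e = {f w, w}" "{v0, w} \<in> E"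
      show ?thesis
        by (rule pair[OF w(1)]) (use f[OF w(2)] edge[OF w(2)] v V' in auto)
    next
      assume "e \<in> {{v0, v1}, {v0, v2}, {v0, v3}, {v1, v2}, {v1, v3}, {v2, v3}}"
      then show ?thesis
        by (elim insertE emptyE) (erule pair; simp add: V' v(1) dist)+
    qed
  qed
  then have "framework V' E' p' \<and> well_positioned P E' p'"
    using good unfolding good_def by (subst well_positioned_framework_iff[OF P]) auto
  moreover have "infinitesimally_rigid P V' E' p'"
    unfolding infinitesimally_rigid_def
  proof (intro allI impI)
    fix u assume u: "infinitesimal_flex P E' p' u"
    have zero: "c \<bullet> (u x - u y) = 0" if "{x, y} \<in> E'" "in_facet_cone P c (p' x - p' y)" for c x y
      using u that(1) poly_norm_flex_iff[OF P that(2), THEN iffD1]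
      unfolding infinitesimal_flex_def by blast
    have K4_edges: "{v1, v0} \<in> E'" "{v3, v0} \<in> E'" "{v3, v2} \<in> E'"
      "{v2, v0} \<in> E'" "{v2, v1} \<in> E'" "{v3, v1} \<in> E'"
      unfolding E' by (simp_all add: insert_commute)
    note a0 = zero[OF K4_edges(1) a'(1)] zero[OF K4_edges(2) a'(2)] zero[OF K4_edges(3) a'(3)]
    note b0 = zero[OF K4_edges(4) b'(1)] zero[OF K4_edges(5) b'(2)] zero[OF K4_edges(6) b'(3)]
    \<comment> \<open>The edges with normal \<open>a\<close> form the path \<open>v1\<close>,
      \<open>v0\<close>, \<open>v3\<close>, \<open>v2\<close>, those with normal \<open>b\<close>
      the path \<open>v0\<close>, \<open>v2\<close>, \<open>v1\<close>, \<open>v3\<close>. Summing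
      along them shows that both normals annihilate the difference.\<close>
    have "u x - u v0 = 0" if "x \<in> {v1, v2, v3}" for x
      using that a0 b0 by (intro ind) (auto simp: inner_diff_right)
    then have u_K4: "u x = u v0" if "x \<in> {v0, v1, v2, v3}" for x
      using that by auto
    \<comment> \<open>The new edge at \<open>w\<close> has kept the normal of the old one, and
      \<open>u\<close> agrees at \<open>f w\<close> and \<open>v0\<close>, so the old condition is
      recovered.\<close>
    have star: "n w \<bullet> (u v0 - u w) = 0" if "{v0, w} \<in> E" for w
    proof -
      have "{f w, w} \<in> E'"
        unfolding E' using that by (intro UnI1[OF UnI2] CollectI exI[of _ w] conjI refl)
      then show ?thesis
        using zero moved[OF that] u_K4[OF f[OF that]] by metis
    qed
    have "infinitesimal_flex P E p u"
      unfolding infinitesimal_flex_def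
    proof (intro allI impI)
      fix x y assume xy: "{x, y} \<in> E"
      have "\<exists>c. in_facet_cone P c (p x - p y) \<and> c \<bullet> (u x - u y) = 0"
      proof -
        consider "x = v0" | "y = v0" | "v0 \<noteq> x" "v0 \<noteq> y"
          by blast
        then show ?thesis
        proof cases
          case 1
          then show ?thesis
            using n star xy by blast
        next
          case 2
          then have "{v0, x} \<in> E"
            using xy by (simp add: insert_commute)
          then have "in_facet_cone P (- n x) (p x - p y)" "- n x \<bullet> (u x - u y) = 0"
            using in_facet_cone_uminus[OF P n[of x]] star[of x] 2 by (simp_all add: inner_diff_right)
          then show ?thesis
            by blast
        next
          case 3
          then have "{x, y} \<in> E'"
            using xy by (simp add: E')
          then show ?thesis
            using zero[of x y] old[OF xy] kept[OF xy 3] by auto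
        qed
      qed
      then show "(\<lambda>t::real. poly_norm P ((p x + t *\<^sub>R u x) - (p y + t *\<^sub>R u y)) - poly_norm P (p x - p y))
          \<in> o[at 0](\<lambda>t. t)"
        by (elim exE conjE) (rule poly_norm_flex_iff[OF P, THEN iffD2])
    qed
    then obtain c where c: "\<forall>v\<in>V. u v = c"
      using assms(5) unfolding infinitesimally_rigid_def by blast
    \<comment> \<open>The old vertex \<open>v0\<close> carries the constant over to the three new
      ones.\<close>
    then have "\<forall>v\<in>V'. u v = c"
      using u_K4 v(1) unfolding V' by auto
    then show "\<exists>c. \<forall>v\<in>V'. u v = c"
      by blast
  qed
  ultimately show ?thesis
    by blast
qed

end
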